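(* Let $a,b$ be positive integers with $a\le b$ and let $f^{a,b}_4(x,y,z,w)=ax^2+by^2+4(z^2+zw+w^2)$. If $f^{a,b}_4$ represents $1$, $2$ and $3$ (with integer arguments), then it represents every nonnegative integer. *)

theory Defs
  imports Main
begin

definition f4 :: "int \<Rightarrow> int \<Rightarrow> int \<Rightarrow> int \<Rightarrow> int \<Rightarrow> int \<Rightarrow> int" where
  "f4 a b x y z w = a * x^2 + b * y^2 + 4 * (z^2 + z * w + w^2)"

definition represents4 :: "int \<Rightarrow> int \<Rightarrow> int \<Rightarrow> bool" where
  "represents4 a b n \<longleftrightarrow> (\<exists>x y z w. f4 a b x y z w = n)"

end

theory Submission
  imports Defs "HOL-Computational_Algebra.Primes"
begin

text \<open>Representing 1, 2 and 3 forces $a = 1$ and $b = 2$. The form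
  $x^2 + 2y^2 + 4(z^2 + zw + w^2)$ is rationally isometric both to
  $x^2 + 6(a^2 + b^2 + c^2)$ and to $(a^2 + b^2 + c^2 + 6t^2)/5$, with gluing conditions modulo 3
  and 5 that signs and permutations of $a, b, c$ can always meet. For each $n$ not divisible by 4,
  one of the two reduces the claim to Gauss's theorem that every $N \<equiv> 3$ modulo 8 is a sum of
  three odd squares.

  For Gauss's theorem let $r(N)$ count the solutions of $x^2 + y^2 + z^2 = N$ in odd integers
  and $e(N)$ those of $xy + yz + zx = N$ in positive odd integers. For odd $m$ both satisfy
  $\<Sum>_h (m - h^2) c(4m - h^2) = 0$, summed over odd $h$: for $r$ by the symmetry between $h$
  and $x$, for $e$ by a windmill-type involution. As $r(3) = 8 e(3)$, it follows that
  $r(N) = 8 e(N)$, and $e(N) > 0$ because of $(1, 1, (N - 1)/2)$.\<close>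

section \<open>Sums of three odd squares\<close>

text \<open>The entries come from a solution of $xy + yz + zx + h^2 = 4m$ through
  $k = (x + y)/2$, $l = k + 2z$, $p = h + (x - y)/2$ and $q = h - (x - y)/2$.\<close>

definition windmills :: "int \<Rightarrow> (int \<times> int \<times> int \<times> int) set" where
  "windmills m = {(k, l, p, q). odd k \<and> odd p \<and> 4 dvd q - p \<and> (l - k) mod 4 = 2 \<and>
     0 < k \<and> k < l \<and> \<bar>p - q\<bar> < 2 * k \<and> k * l + p * q = 4 * m}"

text \<open>Adding $4p$ to $l$ and subtracting $4k$ from $q$ preserves $kl + pq$. In the orbit of
  $(l, q)$ under this translation, the flip passes from the member picked out by $|p - q| < 2k$
  to the one with $k < l < k + 4p$, which is the same kind of condition with $k$ and $p$
  interchanged.\<close>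

definition flip :: "int \<times> int \<times> int \<times> int \<Rightarrow> int \<times> int \<times> int \<times> int" where
  "flip = (\<lambda>(k, l, p, q). (p, q + 2 * k + 4 * k * ((l - k) div (4 * p)),
                          k, k - 2 * p + (l - k) mod (4 * p)))"

text \<open>With \<open>l - k = 4*p*d + r\<close>, the new difference of the first two entries is
  \<open>(q - p + 2*k) + 4*k*d\<close>. The bound \<open>\<bar>p - q\<bar> < 2*k\<close> makes
  \<open>q - p + 2*k\<close> its remainder modulo \<open>4*k\<close>, so a second flip recovers
  \<open>d\<close> and \<open>q\<close>.\<close>

lemma flip_windmill:
  assumes "(k, l, p, q) \<in> windmills m" "0 < p"
  shows "flip (k, l, p, q) \<in> windmills m" "flip (flip (k, l, p, q)) = (k, l, p, q)"
proof -
  define d r where "d = (l - k) div (4 * p)" and "r = (l - k) mod (4 * p)"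
  have kl: "odd k" "odd p" "4 dvd q - p" "(l - k) mod 4 = 2" "0 < k" "k < l"
      "\<bar>p - q\<bar> < 2 * k" "k * l + p * q = 4 * m"
    using assms(1) by (auto simp: windmills_def)
  have l: "l = k + 4 * p * d + r"
    using mult_div_mod_eq[of "4 * p" "l - k"] unfolding d_def r_def by simp
  have r: "0 \<le> r" "r < 4 * p" using assms(2) by (simp_all add: r_def)
  have r4: "r mod 4 = 2" using kl(4) unfolding r_def by (simp add: mod_mod_cancel)
  have d: "0 \<le> d" using kl(6) assms(2) by (simp add: d_def pos_imp_zdiv_nonneg_iff)
  have sw: "flip (k, l, p, q) = (p, q + 2 * k + 4 * k * d, k, k - 2 * p + r)"
    by (simp add: flip_def d_def r_def)
  have "0 \<le> k * d" using d kl(5) by simp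
  hence "p < q + 2 * k + 4 * k * d" using kl(7) by linarith
  \<comment> \<open>At \<open>r = 0\<close> the new difference would reach the excluded bound
    \<open>2*p\<close>; the congruence modulo 4 rules this out.\<close>
  moreover have "r \<noteq> 0" using r4 by auto
  hence "\<bar>k - (k - 2 * p + r)\<bar> < 2 * p" using r by linarith
  moreover have "p * (q + 2 * k + 4 * k * d) + k * (k - 2 * p + r) = 4 * m"
    using kl(8) unfolding l by (simp add: algebra_simps)
  moreover have "4 dvd k - 2 * p + r - k" using kl(2) r4 by presburger
  moreover have "(q + 2 * k + 4 * k * d - p) mod 4 = 2"
  proof -
    have "(q + 2 * k - p) mod 4 = 2" using kl(1,3) by presburger
    moreover have "q + 2 * k + 4 * k * d - p = q + 2 * k - p + 4 * (k * d)" by simp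
    ultimately show ?thesis by (metis mod_mult_self2)
  qed
  ultimately show "flip (k, l, p, q) \<in> windmills m"
    unfolding sw windmills_def using kl(1,2) assms(2) by simp
  have s: "q + 2 * k + 4 * k * d - p = (q - p + 2 * k) + (4 * k) * d" by simp
  have range: "0 \<le> q - p + 2 * k" "q - p + 2 * k < 4 * k" using kl(7) by auto
  have "(q + 2 * k + 4 * k * d - p) div (4 * k) = d"
    unfolding s using range kl(5) by (subst div_mult_self2) (auto simp: div_pos_pos_trivial)
  moreover have "(q + 2 * k + 4 * k * d - p) mod (4 * k) = q - p + 2 * k"
    unfolding s using range by (simp only: mod_mult_self2 mod_pos_pos_trivial)
  ultimately show "flip (flip (k, l, p, q)) = (k, l, p, q)"
    unfolding sw by (simp add: flip_def l)
qed

text \<open>The flip interchanges \<open>k\<close> and \<open>p\<close>, so the sum equals its own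
  negative.\<close>

lemma windmills_sum_pos:
  "(\<Sum>(k, l, p, q) \<in> windmills m \<inter> {(k, l, p, q). 0 < p}. k^2 - p^2) = 0"
proof -
  let ?S = "windmills m \<inter> {(k, l, p, q). 0 < p}"
  have pos: "flip s \<in> {(k, l, p, q). 0 < p}" if "s \<in> windmills m" for s
    using that by (auto simp: flip_def windmills_def)
  have "(\<Sum>(k, l, p, q) \<in> ?S. k^2 - p^2) = (\<Sum>(k, l, p, q) \<in> ?S. p^2 - k^2)"
    by (rule sum.reindex_bij_witness[where i = flip and j = flip])
       (use flip_windmill pos in \<open>auto simp: flip_def\<close>)
  also have "\<dots> = - (\<Sum>(k, l, p, q) \<in> ?S. k^2 - p^2)"
    by (simp add: sum_negf[symmetric] case_prod_beta)
  finally show ?thesis by simp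
qed

section \<open>Weighted sums over quadruples\<close>

lemma abs_le_square: "\<bar>h\<bar> \<le> h^2" for h :: int
  using self_le_power[of "\<bar>h\<bar>" 2] by (cases "h = 0") auto

definition quads :: "int \<Rightarrow> (int \<times> int \<times> int \<times> int) set" where
  "quads m = {(h, x, y, z). odd h \<and> odd x \<and> odd y \<and> odd z \<and> 0 < x \<and> 0 < y \<and> 0 < z \<and>
     x * y + y * z + z * x + h^2 = 4 * m}"

lemma finite_quads: "finite (quads m)"
proof -
  have "quads m \<subseteq> {-4*m..4*m} \<times> {-4*m..4*m} \<times> {-4*m..4*m} \<times> {-4*m..4*m}"
  proof
    fix s assume "s \<in> quads m"
    then obtain h x y z where s: "s = (h, x, y, z)" and
      q: "0 < x" "0 < y" "0 < z" "x * y + y * z + z * x + h^2 = 4 * m"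
      by (auto simp: quads_def)
    have "x \<le> x * y" "y \<le> y * z" "z \<le> z * x" "0 \<le> h^2"
      using q by simp_all
    moreover have "\<bar>h\<bar> \<le> h^2" by (rule abs_le_square)
    ultimately have "\<bar>h\<bar> \<le> 4 * m" "\<bar>x\<bar> \<le> 4 * m" "\<bar>y\<bar> \<le> 4 * m" "\<bar>z\<bar> \<le> 4 * m"
      using q by linarith+
    thus "s \<in> {-4*m..4*m} \<times> {-4*m..4*m} \<times> {-4*m..4*m} \<times> {-4*m..4*m}"
      unfolding s by auto
  qed
  thus ?thesis by (rule finite_subset) auto
qed

text \<open>Dividing the equation by 4 gives
  \<open>ab + bc + ca + a + b + c + 1 + e(e + 1) = m\<close>, which is even when \<open>a\<close>
  and \<open>b\<close> differ in parity. The result makes the windmill entry \<open>k\<close>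
  odd.\<close>

lemma quads_mod4:
  assumes "odd m" "(h, x, y, z) \<in> quads m"
  shows "(x + y) mod 4 = 2"
proof -
  have "odd h" "odd x" "odd y" "odd z" and eq: "x * y + y * z + z * x + h^2 = 4 * m"
    using assms(2) by (auto simp: quads_def)
  then obtain a b c e where xs: "x = 2 * a + 1" "y = 2 * b + 1" "z = 2 * c + 1" "h = 2 * e + 1"
    by (auto elim!: oddE)
  have "a * b + b * c + c * a + a + b + c + 1 + e * (e + 1) = m"
    using eq unfolding xs power2_eq_square by (simp add: algebra_simps)
  hence "odd (a * b + b * c + c * a + a + b + c + 1 + e * (e + 1))" using assms(1) by simp
  hence "even a = even b" by auto
  thus ?thesis unfolding xs by presburger
qed

definition quad_to_windmill :: "int \<times> int \<times> int \<times> int \<Rightarrow> int \<times> int \<times> int \<times> int" where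
  "quad_to_windmill = (\<lambda>(h, x, y, z).
     ((x + y) div 2, (x + y) div 2 + 2 * z, h + (x - y) div 2, h - (x - y) div 2))"

definition windmill_to_quad :: "int \<times> int \<times> int \<times> int \<Rightarrow> int \<times> int \<times> int \<times> int" where
  "windmill_to_quad = (\<lambda>(k, l, p, q).
     ((p + q) div 2, k + (p - q) div 2, k - (p - q) div 2, (l - k) div 2))"

text \<open>With \<open>e = (x - y)/2\<close> one has \<open>x, y = k \<plusminus> e\<close> and
  \<open>p, q = h \<plusminus> e\<close>. Positivity of \<open>x\<close> and \<open>y\<close>
  becomes \<open>\<bar>p - q\<bar> < 2*k\<close>, and positivity of \<open>z\<close> becomes
  \<open>k < l\<close>.\<close>

lemma quad_to_windmill:
  assumes "odd m" "(h, x, y, z) \<in> quads m"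
  shows "windmill_to_quad (quad_to_windmill (h, x, y, z)) = (h, x, y, z)"
    and "quad_to_windmill (h, x, y, z) \<in> windmills m"
    and "(case quad_to_windmill (h, x, y, z) of (k, l, p, q) \<Rightarrow> k^2 - p^2) =
           x * y - h^2 - h * (x - y)"
proof -
  have o: "odd x" "odd y" "odd z" "odd h" "0 < x" "0 < y" "0 < z"
      "x * y + y * z + z * x + h^2 = 4 * m" using assms(2) by (auto simp: quads_def)
  have xy4: "(x + y) mod 4 = 2" by (rule quads_mod4[OF assms])
  define k e where "k = (x + y) div 2" and "e = (x - y) div 2"
  have xy: "x = k + e" "y = k - e" using o(1,2) unfolding k_def e_def by presburger+
  have k: "odd k" using xy4 unfolding xy by presburger
  have e: "even e" using k o(1) unfolding xy by presburger
  have w: "quad_to_windmill (h, x, y, z) = (k, k + 2 * z, h + e, h - e)"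
    by (simp add: quad_to_windmill_def k_def e_def)
  show "windmill_to_quad (quad_to_windmill (h, x, y, z)) = (h, x, y, z)"
    unfolding w by (simp add: windmill_to_quad_def xy)
  have "k * (k + 2 * z) + (h + e) * (h - e) = 4 * m"
    using o(8) unfolding xy by (simp add: algebra_simps power2_eq_square)
  moreover have "4 dvd h - e - (h + e)" "(k + 2 * z - k) mod 4 = 2"
    using e o(3) by presburger+
  ultimately show "quad_to_windmill (h, x, y, z) \<in> windmills m"
    unfolding w windmills_def using o(4-7) k e unfolding xy by auto
  show "(case quad_to_windmill (h, x, y, z) of (k, l, p, q) \<Rightarrow> k^2 - p^2) =
           x * y - h^2 - h * (x - y)"
    unfolding w by (simp add: xy algebra_simps power2_eq_square)
qed

lemma windmill_to_quad:
  assumes "(k, l, p, q) \<in> windmills m"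
  shows "quad_to_windmill (windmill_to_quad (k, l, p, q)) = (k, l, p, q)"
    and "windmill_to_quad (k, l, p, q) \<in> quads m"
proof -
  have w: "odd k" "odd p" "4 dvd q - p" "(l - k) mod 4 = 2" "0 < k" "k < l"
      "\<bar>p - q\<bar> < 2 * k" "k * l + p * q = 4 * m"
    using assms by (auto simp: windmills_def)
  define z e h where "z = (l - k) div 2" and "e = (p - q) div 2" and "h = (p + q) div 2"
  have eqs: "l = k + 2 * z" "p = h + e" "q = h - e"
    using w(2-4) unfolding z_def e_def h_def by presburger+
  have par: "odd z" "even e" using w(3,4) unfolding eqs by presburger+
  have h: "odd h" using w(2) par unfolding eqs by presburger
  have q: "windmill_to_quad (k, l, p, q) = (h, k + e, k - e, z)"
    by (simp add: windmill_to_quad_def z_def e_def h_def)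
  show "quad_to_windmill (windmill_to_quad (k, l, p, q)) = (k, l, p, q)"
    unfolding q by (simp add: quad_to_windmill_def eqs)
  have "(k + e) * (k - e) + (k - e) * z + z * (k + e) + h^2 = 4 * m"
    using w(8) unfolding eqs by (simp add: algebra_simps power2_eq_square)
  thus "windmill_to_quad (k, l, p, q) \<in> quads m"
    unfolding q quads_def using w(1,5-7) par h unfolding eqs by auto
qed

lemma windmills_sum_quads:
  assumes "odd m"
  shows "(\<Sum>(k, l, p, q) \<in> windmills m. k^2 - p^2) =
         (\<Sum>(h, x, y, z) \<in> quads m. x * y - h^2 - h * (x - y))"
proof (rule sum.reindex_bij_witness[where i = quad_to_windmill and j = windmill_to_quad])
  fix s assume s: "s \<in> windmills m"
  obtain k l p q where [simp]: "s = (k, l, p, q)" by (cases s)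
  show 1: "quad_to_windmill (windmill_to_quad s) = s" and 2: "windmill_to_quad s \<in> quads m"
    using windmill_to_quad s by auto
  obtain h x y z where hq: "windmill_to_quad s = (h, x, y, z)" by (cases "windmill_to_quad s")
  show "(case windmill_to_quad s of (h, x, y, z) \<Rightarrow> x * y - h^2 - h * (x - y)) =
        (case s of (k, l, p, q) \<Rightarrow> k^2 - p^2)"
    using quad_to_windmill(3)[OF assms, of h x y z] 1 2 unfolding hq by simp
next
  fix s assume "s \<in> quads m"
  thus "windmill_to_quad (quad_to_windmill s) = s" "quad_to_windmill s \<in> windmills m"
    using quad_to_windmill(1,2)[OF assms] by (cases s; auto)+
qed

lemma finite_windmills:
  assumes "odd m"
  shows "finite (windmills m)"
proof -
  have "windmills m \<subseteq> quad_to_windmill ` quads m"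
    by (force simp: image_iff dest: windmill_to_quad)
  thus ?thesis using finite_quads finite_subset by blast
qed

text \<open>Negating \<open>p\<close> and \<open>q\<close> keeps the weight and exchanges the halves
  \<open>p > 0\<close> and \<open>p < 0\<close>; \<open>p\<close> is odd, hence never 0.\<close>

lemma windmills_sum:
  assumes "odd m"
  shows "(\<Sum>(k, l, p, q) \<in> windmills m. k^2 - p^2) = 0"
proof -
  let ?P = "{(k, l, p, q). (0::int) < p} :: (int \<times> int \<times> int \<times> int) set"
  let ?g = "\<lambda>(k, l, p, q). k^2 - p^2 :: int"
  let ?n = "\<lambda>(k, l, p, q). (k, l, - p, - q) :: int \<times> int \<times> int \<times> int"
  have "sum ?g (windmills m - ?P) = sum ?g (windmills m \<inter> ?P)"
    by (rule sum.reindex_bij_witness[where i = ?n and j = ?n])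
       (auto simp: windmills_def abs_minus_commute dvd_diff_commute intro: ccontr)
  moreover have "sum ?g (windmills m) = sum ?g (windmills m \<inter> ?P) + sum ?g (windmills m - ?P)"
    by (subst sum.union_disjoint[symmetric])
       (auto simp: finite_windmills[OF assms] Int_Diff_Un)
  ultimately show ?thesis using windmills_sum_pos[of m] by simp
qed

text \<open>Swapping \<open>x\<close> and \<open>y\<close> kills the sum of \<open>h(x - y)\<close>,
  so the windmill identity says that \<open>xy\<close> and \<open>h^2\<close> have equal sums. By
  rotation so do \<open>yz\<close> and \<open>zx\<close>, while
  \<open>4(m - h^2) = xy + yz + zx - 3h^2\<close>.\<close>

lemma quads_sum:
  assumes "odd m"
  shows "(\<Sum>(h, x, y, z) \<in> quads m. m - h^2) = 0"
proof -
  let ?s = "\<lambda>(h, x, y, z). (h, y, x, z) :: int \<times> int \<times> int \<times> int"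
  let ?r = "\<lambda>(h, x, y, z). (h, y, z, x) :: int \<times> int \<times> int \<times> int"
  let ?r' = "\<lambda>(h, x, y, z). (h, z, x, y) :: int \<times> int \<times> int \<times> int"
  let ?S = "\<lambda>f. \<Sum>(h, x, y, z) \<in> quads m. f h x y z :: int"
  have "?S (\<lambda>h x y z. h * (x - y)) = ?S (\<lambda>h x y z. h * (y - x))"
    by (rule sum.reindex_bij_witness[where i = ?s and j = ?s])
       (auto simp: quads_def algebra_simps)
  also have "\<dots> = - ?S (\<lambda>h x y z. h * (x - y))"
    by (simp add: sum_negf[symmetric] case_prod_beta algebra_simps)
  finally have 1: "?S (\<lambda>h x y z. h * (x - y)) = 0" by simp
  have 2: "?S (\<lambda>h x y z. x * y) = ?S (\<lambda>h x y z. y * z)"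
    by (rule sum.reindex_bij_witness[where i = ?r and j = ?r'])
       (auto simp: quads_def algebra_simps)
  have 3: "?S (\<lambda>h x y z. y * z) = ?S (\<lambda>h x y z. z * x)"
    by (rule sum.reindex_bij_witness[where i = ?r and j = ?r'])
       (auto simp: quads_def algebra_simps)
  have "?S (\<lambda>h x y z. x * y - h^2 - h * (x - y)) = 0"
    using windmills_sum_quads[OF assms] windmills_sum[OF assms] by simp
  hence 4: "?S (\<lambda>h x y z. x * y) = ?S (\<lambda>h x y z. h^2)"
    using 1 by (simp add: case_prod_beta sum_subtractf)
  have "4 * ?S (\<lambda>h x y z. m - h^2) = ?S (\<lambda>h x y z. 4 * (m - h^2))"
    by (simp add: sum_distrib_left case_prod_beta right_diff_distrib)
  also have "\<dots> = ?S (\<lambda>h x y z. x * y + y * z + z * x - 3 * h^2)"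
    by (rule sum.cong) (auto simp: quads_def)
  also have "\<dots> = 0"
    using 2 3 4 by (simp add: case_prod_beta sum_subtractf sum.distrib sum_distrib_left[symmetric])
  finally show ?thesis by simp
qed

definition square_quads :: "int \<Rightarrow> (int \<times> int \<times> int \<times> int) set" where
  "square_quads m = {(h, x, y, z). odd h \<and> odd x \<and> odd y \<and> odd z \<and> x^2 + y^2 + z^2 + h^2 = 4 * m}"

text \<open>All four coordinates are interchangeable, and
  \<open>4(m - h^2) = x^2 + y^2 + z^2 - 3h^2\<close>.\<close>

lemma square_quads_sum: "(\<Sum>(h, x, y, z) \<in> square_quads m. m - h^2) = 0"
proof -
  let ?s = "\<lambda>(h, x, y, z). (x, h, y, z) :: int \<times> int \<times> int \<times> int"
  let ?r = "\<lambda>(h, x, y, z). (h, y, z, x) :: int \<times> int \<times> int \<times> int"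
  let ?r' = "\<lambda>(h, x, y, z). (h, z, x, y) :: int \<times> int \<times> int \<times> int"
  let ?S = "\<lambda>f. \<Sum>(h, x, y, z) \<in> square_quads m. f h x y z :: int"
  have 1: "?S (\<lambda>h x y z. x^2) = ?S (\<lambda>h x y z. h^2)"
    by (rule sum.reindex_bij_witness[where i = ?s and j = ?s])
       (auto simp: square_quads_def algebra_simps)
  have 2: "?S (\<lambda>h x y z. x^2) = ?S (\<lambda>h x y z. y^2)"
    by (rule sum.reindex_bij_witness[where i = ?r and j = ?r'])
       (auto simp: square_quads_def algebra_simps)
  have 3: "?S (\<lambda>h x y z. y^2) = ?S (\<lambda>h x y z. z^2)"
    by (rule sum.reindex_bij_witness[where i = ?r and j = ?r'])
       (auto simp: square_quads_def algebra_simps)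
  have "4 * ?S (\<lambda>h x y z. m - h^2) = ?S (\<lambda>h x y z. 4 * (m - h^2))"
    by (simp add: sum_distrib_left case_prod_beta right_diff_distrib)
  also have "\<dots> = ?S (\<lambda>h x y z. x^2 + y^2 + z^2 - 3 * h^2)"
    by (rule sum.cong) (auto simp: square_quads_def)
  also have "\<dots> = 0"
    using 1 2 3 by (simp add: case_prod_beta sum_subtractf sum.distrib sum_distrib_left[symmetric])
  finally show ?thesis by simp
qed

section \<open>The counts e(N) and r(N) and their recurrences\<close>

definition hyp_triples :: "int \<Rightarrow> (int \<times> int \<times> int) set" where
  "hyp_triples N = {(x, y, z). odd x \<and> odd y \<and> odd z \<and> 0 < x \<and> 0 < y \<and> 0 < z \<and>
     x * y + y * z + z * x = N}"

definition sq_triples :: "int \<Rightarrow> (int \<times> int \<times> int) set" where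
  "sq_triples N = {(x, y, z). odd x \<and> odd y \<and> odd z \<and> x^2 + y^2 + z^2 = N}"

lemma hyp_triples_pos:
  assumes "t \<in> hyp_triples N"
  shows "0 < N"
proof -
  obtain x y z where "0 < x" "0 < y" "0 < z" "x * y + y * z + z * x = N"
    using assms by (auto simp: hyp_triples_def)
  moreover from this have "0 < x * y" "0 < y * z" "0 < z * x" by simp_all
  ultimately show ?thesis by linarith
qed

lemma sq_triples_nonneg:
  assumes "t \<in> sq_triples N"
  shows "0 \<le> N"
proof -
  obtain x y z where "x^2 + y^2 + z^2 = N"
    using assms by (auto simp: sq_triples_def)
  moreover have "0 \<le> x^2 + y^2 + z^2" by simp
  ultimately show ?thesis by simp
qed

lemma finite_hyp_triples: "finite (hyp_triples N)"
proof -
  have "hyp_triples N \<subseteq> {0..N} \<times> {0..N} \<times> {0..N}"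
  proof
    fix s assume "s \<in> hyp_triples N"
    then obtain x y z where s: "s = (x, y, z)" and
      q: "0 < x" "0 < y" "0 < z" "x * y + y * z + z * x = N"
      by (auto simp: hyp_triples_def)
    have "x \<le> x * y" "y \<le> y * z" "z \<le> z * x" using q by simp_all
    hence "x \<le> N" "y \<le> N" "z \<le> N" using q by linarith+
    thus "s \<in> {0..N} \<times> {0..N} \<times> {0..N}" unfolding s using q by simp
  qed
  thus ?thesis by (rule finite_subset) auto
qed

lemma finite_sq_triples: "finite (sq_triples N)"
proof -
  have "sq_triples N \<subseteq> {-N..N} \<times> {-N..N} \<times> {-N..N}"
  proof
    fix s assume "s \<in> sq_triples N"
    then obtain x y z where s: "s = (x, y, z)" and q: "x^2 + y^2 + z^2 = N"
      by (auto simp: sq_triples_def)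
    have "\<bar>x\<bar> \<le> N" "\<bar>y\<bar> \<le> N" "\<bar>z\<bar> \<le> N"
      using q abs_le_square[of x] abs_le_square[of y] abs_le_square[of z] by linarith+
    thus "s \<in> {-N..N} \<times> {-N..N} \<times> {-N..N}" unfolding s by auto
  qed
  thus ?thesis by (rule finite_subset) auto
qed

text \<open>The window is a crude one, from
  \<open>\<bar>h\<bar> \<le> h^2 \<le> 4*m\<close>.\<close>

definition odds :: "int \<Rightarrow> int set" where
  "odds m = {h \<in> {-4*m..4*m}. odd h}"

lemma finite_odds: "finite (odds m)"
  unfolding odds_def by (rule finite_subset[of _ "{-4*m..4*m}"]) auto

lemma sum_fibres:
  assumes "\<And>N. finite (T N)" and "\<And>h t. t \<in> T (4 * m - h^2) \<Longrightarrow> h^2 \<le> 4 * m"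
    and "Q = {(h, t). odd h \<and> t \<in> T (4 * m - h^2)}"
  shows "(\<Sum>(h, t) \<in> Q. m - h^2) = (\<Sum>h \<in> odds m. (m - h^2) * int (card (T (4 * m - h^2))))"
proof -
  have "Q = (SIGMA h:odds m. T (4 * m - h^2))"
  proof -
    have "h \<in> {-4*m..4*m}" if "t \<in> T (4 * m - h^2)" for h t
      using assms(2)[OF that] abs_le_square[of h] by auto
    thus ?thesis unfolding assms(3) odds_def by auto
  qed
  moreover have "(\<Sum>h \<in> odds m. \<Sum>t \<in> T (4 * m - h^2). m - h^2) =
      (\<Sum>(h, t) \<in> (SIGMA h:odds m. T (4 * m - h^2)). m - h^2)"
    by (rule sum.Sigma) (use assms(1) finite_odds in auto)
  ultimately have "(\<Sum>(h, t) \<in> Q. m - h^2) = (\<Sum>h \<in> odds m. \<Sum>t \<in> T (4 * m - h^2). m - h^2)"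
    by simp
  thus ?thesis by (simp add: mult.commute)
qed

lemma hyp_recurrence:
  assumes "odd m"
  shows "(\<Sum>h \<in> odds m. (m - h^2) * int (card (hyp_triples (4 * m - h^2)))) = 0"
proof -
  have "h^2 \<le> 4 * m" if "t \<in> hyp_triples (4 * m - h^2)" for h t
    using hyp_triples_pos[OF that] by simp
  moreover have "quads m = {(h, t). odd h \<and> t \<in> hyp_triples (4 * m - h^2)}"
    by (auto simp: quads_def hyp_triples_def algebra_simps)
  ultimately have "(\<Sum>(h, t) \<in> quads m. m - h^2) =
      (\<Sum>h \<in> odds m. (m - h^2) * int (card (hyp_triples (4 * m - h^2))))"
    by (intro sum_fibres finite_hyp_triples)
  thus ?thesis using quads_sum[OF assms] by (simp add: case_prod_beta)
qed

lemma sq_recurrence: "(\<Sum>h \<in> odds m. (m - h^2) * int (card (sq_triples (4 * m - h^2)))) = 0"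
proof -
  have "h^2 \<le> 4 * m" if "t \<in> sq_triples (4 * m - h^2)" for h t
    using sq_triples_nonneg[OF that] by simp
  moreover have "square_quads m = {(h, t). odd h \<and> t \<in> sq_triples (4 * m - h^2)}"
    by (auto simp: square_quads_def sq_triples_def algebra_simps)
  ultimately have "(\<Sum>(h, t) \<in> square_quads m. m - h^2) =
      (\<Sum>h \<in> odds m. (m - h^2) * int (card (sq_triples (4 * m - h^2))))"
    by (intro sum_fibres finite_sq_triples)
  thus ?thesis using square_quads_sum[of m] by (simp add: case_prod_beta)
qed

section \<open>Uniqueness for the recurrence and Gauss's theorem\<close>

text \<open>The recurrence leaves $c(3)$ free because its coefficient $m - h^2$ vanishes for
  $m = 1$, $h = \<plusminus>1$.\<close>

lemma recurrence_unique:
  fixes c :: "int \<Rightarrow> int"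
  assumes rec: "\<And>m. odd m \<Longrightarrow> (\<Sum>h \<in> odds m. (m - h^2) * c (4 * m - h^2)) = 0"
    and neg: "\<And>N. N < 0 \<Longrightarrow> c N = 0" and c3: "c 3 = 0"
  shows "odd m \<Longrightarrow> c (4 * m - 1) = 0"
proof (induction "nat m" arbitrary: m rule: less_induct)
  case less
  consider "m \<le> 0" | "m = 1" | "1 < m" by linarith
  thus ?case
  proof cases
    case 3
    have zero: "c (4 * m - h^2) = 0" if h: "odd h" "h \<noteq> 1" "h \<noteq> -1" for h
    proof -
      obtain j where j: "h = 2 * j + 1" using h(1) by (elim oddE)
      \<comment> \<open>Since \<open>h^2 = 8*i + 1\<close>, the argument is \<open>4*m' - 1\<close>
        for the smaller odd number \<open>m' = m - 2*i\<close>.\<close>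
      have "even (j * (j + 1))" by simp
      then obtain i where i: "j * (j + 1) = 2 * i" by (elim evenE)
      have h2: "4 * m - h^2 = 4 * (m - 2 * i) - 1"
        using i unfolding j power2_eq_square by (simp add: algebra_simps)
      have "j \<ge> 1 \<or> j \<le> -2" using h j by presburger
      hence "0 < j * (j + 1)" by (auto simp: zero_less_mult_iff)
      hence "0 < i" using i by simp
      show ?thesis
      proof (cases "m - 2 * i \<le> 0")
        case True
        thus ?thesis unfolding h2 by (intro neg) simp
      next
        case False
        thus ?thesis unfolding h2 using less.hyps[of "m - 2 * i"] less.prems \<open>0 < i\<close> by simp
      qed
    qed
    \<comment> \<open>Only \<open>h = 1\<close> and \<open>h = -1\<close> survive, both with the
      coefficient \<open>m - 1\<close>, nonzero as \<open>1 < m\<close>.\<close>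
    have "(\<Sum>h \<in> odds m. (m - h^2) * c (4 * m - h^2)) = (\<Sum>h \<in> {1, -1}. (m - h^2) * c (4 * m - h^2))"
      using zero 3 finite_odds[of m] by (intro sum.mono_neutral_right) (auto simp: odds_def)
    hence "2 * ((m - 1) * c (4 * m - 1)) = 0" using rec[OF less.prems] by simp
    thus ?thesis using 3 by simp
  qed (use neg c3 in auto)
qed

lemma hyp_triples_3: "hyp_triples 3 = {(1, 1, 1)}"
proof -
  have "x = 1 \<and> y = 1 \<and> z = 1" if "0 < x" "0 < y" "0 < z" "x * y + y * z + z * x = 3" for x y z :: int
  proof -
    have "x \<le> x * y" "y \<le> y * z" "z \<le> z * x" "y \<le> x * y" "z \<le> y * z" "x \<le> z * x"
      using that by simp_all
    thus ?thesis using that by linarith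
  qed
  thus ?thesis by (auto simp: hyp_triples_def)
qed

lemma sq_triples_3: "sq_triples 3 = {1, -1} \<times> {1, -1} \<times> {1, -1}"
proof -
  have sq: "x = 1 \<or> x = -1" if "odd x" "x^2 \<le> 1" for x :: int
  proof -
    have "\<bar>x\<bar> \<le> 1" using that(2) abs_square_le_1 by blast
    thus ?thesis using that(1) by presburger
  qed
  have sq1: "1 \<le> x^2" if "odd x" for x :: int
  proof -
    have "x \<noteq> 0" using that by auto
    hence "0 < x^2" by simp
    thus ?thesis by linarith
  qed
  have "(x = 1 \<or> x = -1) \<and> (y = 1 \<or> y = -1) \<and> (z = 1 \<or> z = -1)"
    if "odd x" "odd y" "odd z" "x^2 + y^2 + z^2 = 3" for x y z :: int
    using that sq[of x] sq[of y] sq[of z] sq1[of x] sq1[of y] sq1[of z] by linarith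
  hence "sq_triples 3 \<subseteq> {1, -1} \<times> {1, -1} \<times> {1, -1}"
    unfolding sq_triples_def by blast
  moreover have "{1, -1} \<times> {1, -1} \<times> {1, -1} \<subseteq> sq_triples 3"
    by (auto simp: sq_triples_def)
  ultimately show ?thesis by blast
qed

text \<open>The difference r - 8e satisfies the recurrence and vanishes at 3 and at negative
  arguments, hence at \<open>N = 4*m - 1\<close>.\<close>

lemma three_odd_squares:
  fixes N :: int
  assumes "0 < N" "N mod 8 = 3"
  obtains x y z :: int where "odd x" "odd y" "odd z" "x^2 + y^2 + z^2 = N"
proof -
  define m where "m = (N + 1) div 4"
  have m: "N = 4 * m - 1" "odd m" using assms(2) unfolding m_def by presburger+
  define c where "c = (\<lambda>N. int (card (sq_triples N)) - 8 * int (card (hyp_triples N)))"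
  have "c (4 * m - 1) = 0"
  proof (rule recurrence_unique[OF _ _ _ m(2)])
    fix m :: int assume "odd m"
    have "(\<Sum>h \<in> odds m. (m - h^2) * c (4 * m - h^2)) =
        (\<Sum>h \<in> odds m. (m - h^2) * int (card (sq_triples (4 * m - h^2)))) -
        8 * (\<Sum>h \<in> odds m. (m - h^2) * int (card (hyp_triples (4 * m - h^2))))"
      by (simp only: c_def sum_distrib_left sum_subtractf[symmetric] right_diff_distrib mult.left_commute)
    thus "(\<Sum>h \<in> odds m. (m - h^2) * c (4 * m - h^2)) = 0"
      using hyp_recurrence[OF \<open>odd m\<close>] sq_recurrence[of m] by simp
  next
    fix N :: int assume "N < 0"
    hence "t \<notin> hyp_triples N" "t \<notin> sq_triples N" for t
      using hyp_triples_pos[of t N] sq_triples_nonneg[of t N] by auto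
    hence "hyp_triples N = {}" "sq_triples N = {}" by blast+
    thus "c N = 0" by (simp add: c_def)
  next
    show "c 3 = 0" by (simp add: c_def hyp_triples_3 sq_triples_3)
  qed
  moreover have "0 < 2 * m - 1" using assms(1) m(1) by presburger
  hence "(1, 1, 2 * m - 1) \<in> hyp_triples (4 * m - 1)"
    by (simp add: hyp_triples_def)
  hence "card (hyp_triples (4 * m - 1)) \<noteq> 0" using finite_hyp_triples by auto
  ultimately have "sq_triples N \<noteq> {}" unfolding c_def m(1) by auto
  thus thesis using that by (auto simp: sq_triples_def)
qed

section \<open>The quaternary form\<close>

lemma square_mod_3: "x^2 mod 3 = (if 3 dvd x then 0 else 1)" for x :: int
proof -
  have "x^2 mod 3 = (x mod 3)^2 mod 3" by (simp add: power_mod)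
  moreover have "x mod 3 = 0 \<or> x mod 3 = 1 \<or> x mod 3 = 2" by presburger
  ultimately show ?thesis by (elim disjE) (simp_all add: dvd_eq_mod_eq_0)
qed

lemma square_mod_5: "x^2 mod 5 = 0 \<or> x^2 mod 5 = 1 \<or> x^2 mod 5 = 4" for x :: int
proof -
  have "x^2 mod 5 = (x mod 5)^2 mod 5" by (simp add: power_mod)
  moreover have "x mod 5 = 0 \<or> x mod 5 = 1 \<or> x mod 5 = 2 \<or> x mod 5 = 3 \<or> x mod 5 = 4"
    by presburger
  ultimately show ?thesis by auto
qed

text \<open>As -1 is a square modulo 5, \<open>x^2 + y^2\<close> splits there into linear factors,
  which differ by a sign change.\<close>

lemma sum_squares_dvd_5:
  fixes x y :: int
  assumes "5 dvd x^2 + y^2"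
  shows "5 dvd y - 3 * x \<or> 5 dvd - y - 3 * x" "5 dvd x - 2 * y \<or> 5 dvd - x - 2 * y"
proof -
  have prime: "prime (5 :: int)" by simp
  have "(y - 3 * x) * (- y - 3 * x) = 5 * (2 * x^2) - (x^2 + y^2)"
    by (simp add: power2_eq_square algebra_simps)
  hence "5 dvd (y - 3 * x) * (- y - 3 * x)"
    using assms by (metis dvd_diff dvd_triv_left)
  thus "5 dvd y - 3 * x \<or> 5 dvd - y - 3 * x" using prime_dvd_multD[OF prime] by blast
  have "(x - 2 * y) * (- x - 2 * y) = 5 * y^2 - (x^2 + y^2)"
    by (simp add: power2_eq_square algebra_simps)
  hence "5 dvd (x - 2 * y) * (- x - 2 * y)"
    using assms by (metis dvd_diff dvd_triv_left)
  thus "5 dvd x - 2 * y \<or> 5 dvd - x - 2 * y" using prime_dvd_multD[OF prime] by blast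
qed

text \<open>Squares are 0 or 1 modulo 3, so either all three entries are divisible by 3 or none
  is.\<close>

lemma sum_squares_dvd_3:
  fixes x y z :: int
  assumes "3 dvd x^2 + y^2 + z^2"
  shows "3 dvd y - x \<or> 3 dvd - y - x"
proof -
  have "(x^2 mod 3 + y^2 mod 3 + z^2 mod 3) mod 3 = (x^2 + y^2 + z^2) mod 3"
    by (intro mod_add_cong mod_mod_trivial)
  hence "3 dvd x \<longleftrightarrow> 3 dvd y" using assms by (simp add: square_mod_3 split: if_splits)
  thus ?thesis by presburger
qed

text \<open>Squares are $0$ or $\<plusminus>1$ modulo 5, so four of them whose sum is divisible by 5 split
  into two pairs of opposite residues.\<close>

lemma balanced_mod_5:
  fixes p q r s :: int
  assumes "(p + q + r + s) mod 5 = 0" "p = 0 \<or> p = 1 \<or> p = 4" "q = 0 \<or> q = 1 \<or> q = 4"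
    "r = 0 \<or> r = 1 \<or> r = 4" "s = 0 \<or> s = 1 \<or> s = 4"
  shows "((p + q) mod 5 = 0 \<and> (r + s) mod 5 = 0) \<or> ((q + r) mod 5 = 0 \<and> (p + s) mod 5 = 0) \<or>
    ((r + p) mod 5 = 0 \<and> (q + s) mod 5 = 0)"
  using assms by (elim disjE; hypsubst; simp)

section \<open>The two rational isometries\<close>

text \<open>If $3M = a^2 + b^2 + c^2$ then, after sign changes, $a \<equiv> b \<equiv> c$ modulo 3, and
  $y = (a + b + c)/3$ works.\<close>

lemma one_mod_8_repr:
  fixes M :: int
  assumes "0 < M" "M mod 8 = 1"
  obtains y z w where "M = y^2 + 2 * (z^2 + z * w + w^2)"
proof -
  have "0 < 3 * M" "(3 * M) mod 8 = 3" using assms by presburger+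
  then obtain a b c where abc: "a^2 + b^2 + c^2 = 3 * M"
    using three_odd_squares by metis
  hence dvd: "3 dvd a^2 + b^2 + c^2" and dvd': "3 dvd a^2 + c^2 + b^2" by (simp_all add: ac_simps)
  obtain i where "b - a = 3 * i \<or> - b - a = 3 * i"
    using sum_squares_dvd_3[OF dvd] unfolding dvd_def by blast
  moreover obtain j where "c - a = 3 * j \<or> - c - a = 3 * j"
    using sum_squares_dvd_3[OF dvd'] unfolding dvd_def by blast
  ultimately have "b = a + 3 * i \<or> b = - (a + 3 * i)" "c = a + 3 * j \<or> c = - (a + 3 * j)"
    by linarith+
  hence "b^2 = (a + 3 * i)^2" "c^2 = (a + 3 * j)^2"
    by (simp_all only: power2_eq_iff)
  \<comment> \<open>The square comes from the direction (1, 1, 1), the binary form from the plane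
    orthogonal to it.\<close>
  hence "3 * M = 3 * ((a + i + j)^2 + 2 * (i^2 + i * (- j) + (- j)^2))"
    unfolding abc[symmetric] by (simp add: power2_eq_square algebra_simps)
  hence "M = (a + i + j)^2 + 2 * (i^2 + i * (- j) + (- j)^2)"
    by (simp only: mult_cancel_left) simp
  thus thesis by (rule that)
qed

lemma represents4_I: "a * x^2 + b * y^2 + 4 * (z^2 + z * w + w^2) = n \<Longrightarrow> represents4 a b n"
  unfolding represents4_def f4_def by blast

text \<open>Twice the form in \<open>one_mod_8_repr\<close> is
  \<open>2y^2 + 4(z^2 + zw + w^2)\<close>, and scaling its variables by \<open>s\<close> multiplies
  it by \<open>s^2\<close>.\<close>

lemma represents4_square_plus:
  assumes "n = x^2 + 2 * s^2 * (8 * k + 1)" "0 \<le> k"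
  shows "represents4 1 2 n"
proof -
  obtain y z w where M: "8 * k + 1 = y^2 + 2 * (z^2 + z * w + w^2)"
    using one_mod_8_repr[of "8 * k + 1"] assms(2) by auto
  show ?thesis
    by (rule represents4_I[where x = x and y = "s * y" and z = "s * z" and w = "s * w"])
       (simp only: assms(1) M, simp add: power2_eq_square algebra_simps)
qed

text \<open>Over the rationals the form is isometric to $(a^2 + b^2 + c^2 + 6t^2)/5$, via
  $x = (2a + b)/5$, $u = (2b - a)/5$, $y = (c + 3t)/5$, $w = (2t - c)/5$ and
  $n = x^2 + 2y^2 + u^2 + 3w^2$, where $u = 2z + w$.\<close>

lemma represents4_isotropic:
  fixes a b c t n :: int
  assumes "a^2 + b^2 + c^2 + 6 * t^2 = 5 * n" "5 dvd b - 3 * a" "5 dvd c - 2 * t"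
    and "even a = even b" "even a = even c"
  shows "represents4 1 2 n"
proof -
  obtain i where "b - 3 * a = 5 * i" using assms(2) by (elim dvdE)
  hence b: "b = 3 * a + 5 * i" by simp
  obtain j where "c - 2 * t = 5 * j" using assms(3) by (elim dvdE)
  hence c: "c = 2 * t + 5 * j" by simp
  \<comment> \<open>This is u - w, which must be even for u = 2z + w; \<open>j\<close> has the
    parity of \<open>c\<close>, hence of \<open>a\<close>.\<close>
  have "even (a + 2 * i + j)" using assms(4,5) unfolding b c by presburger
  then obtain z where z: "a + 2 * i + j = 2 * z" by (elim evenE)
  hence j: "j = 2 * z - a - 2 * i" by simp
  have "5 * ((a + i)^2 + 2 * (t + j)^2 + 4 * (z^2 + z * (- j) + (- j)^2)) = 5 * n"
    unfolding assms(1)[symmetric] b c j by (simp add: power2_eq_square algebra_simps)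
  thus ?thesis by (intro represents4_I[of 1 "a + i" 2 "t + j" z "- j"]) simp
qed

lemma represents4_isotropic_sign:
  fixes a b c t n :: int
  assumes "a^2 + b^2 + c^2 + 6 * t^2 = 5 * n" "5 dvd a^2 + b^2" "5 dvd c^2 + t^2"
    and "even a = even b" "even a = even c"
  shows "represents4 1 2 n"
proof -
  have "5 dvd b - 3 * a \<or> 5 dvd - b - 3 * a"
    using sum_squares_dvd_5(1)[OF assms(2)] .
  moreover have "5 dvd c - 2 * t \<or> 5 dvd - c - 2 * t"
    using sum_squares_dvd_5(2)[OF assms(3)] .
  ultimately obtain b' c' where "b' = b \<or> b' = - b" "c' = c \<or> c' = - c"
    and dvd: "5 dvd b' - 3 * a" "5 dvd c' - 2 * t"
    by blast
  hence "b'^2 = b^2" "c'^2 = c^2" "even b' = even b" "even c' = even c" by auto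
  thus ?thesis using represents4_isotropic[OF _ dvd] assms(1,4,5) by simp
qed

text \<open>As \<open>6*t^2\<close> is \<open>t^2\<close> modulo 5, the four squares sum to 0 there.
  They split into balanced pairs, and permuting \<open>a\<close>, \<open>b\<close>, \<open>c\<close>
  pairs \<open>t\<close> with the last one.\<close>

lemma represents4_sum_squares:
  fixes a b c t n :: int
  assumes eq: "a^2 + b^2 + c^2 + 6 * t^2 = 5 * n" and "even a = even b" "even a = even c"
  shows "represents4 1 2 n"
proof -
  have dvd_iff: "5 dvd p + q \<longleftrightarrow> (p mod 5 + q mod 5) mod 5 = 0" for p q :: int
    by (simp add: dvd_eq_mod_eq_0 mod_add_eq)
  have "a^2 + b^2 + c^2 + t^2 = 5 * (n - t^2)" using eq by simp
  hence "(a^2 + b^2 + c^2 + t^2) mod 5 = 0" by (simp only: mod_mult_self1_is_0)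
  moreover have "(a^2 mod 5 + b^2 mod 5 + c^2 mod 5 + t^2 mod 5) mod 5 = (a^2 + b^2 + c^2 + t^2) mod 5"
    by (intro mod_add_cong mod_mod_trivial)
  ultimately have "(a^2 mod 5 + b^2 mod 5 + c^2 mod 5 + t^2 mod 5) mod 5 = 0" by simp
  hence "(5 dvd a^2 + b^2 \<and> 5 dvd c^2 + t^2) \<or> (5 dvd b^2 + c^2 \<and> 5 dvd a^2 + t^2) \<or>
      (5 dvd c^2 + a^2 \<and> 5 dvd b^2 + t^2)"
    unfolding dvd_iff by (rule balanced_mod_5) (rule square_mod_5)+
  thus ?thesis
  proof (elim disjE conjE)
    assume "5 dvd a^2 + b^2" "5 dvd c^2 + t^2"
    thus ?thesis by (rule represents4_isotropic_sign[OF assms(1)]) (use assms in auto)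
  next
    assume "5 dvd b^2 + c^2" "5 dvd a^2 + t^2"
    moreover have "b^2 + c^2 + a^2 + 6 * t^2 = 5 * n" using eq by simp
    ultimately show ?thesis
      using represents4_isotropic_sign[of b c a t n] assms(2,3) by blast
  next
    assume "5 dvd c^2 + a^2" "5 dvd b^2 + t^2"
    moreover have "c^2 + a^2 + b^2 + 6 * t^2 = 5 * n" using eq by simp
    ultimately show ?thesis
      using represents4_isotropic_sign[of c a b t n] assms(2,3) by blast
  qed
qed

text \<open>Scaling three odd numbers by \<open>s\<close> keeps their parities equal.\<close>

lemma represents4_five:
  assumes "5 * n = 6 * t^2 + s^2 * (8 * k + 3)" "0 \<le> k"
  shows "represents4 1 2 n"
proof -
  obtain a b c where "odd a" "odd b" "odd c" and N: "a^2 + b^2 + c^2 = 8 * k + 3"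
    using three_odd_squares[of "8 * k + 3"] assms(2) by auto
  moreover have "(s * a)^2 + (s * b)^2 + (s * c)^2 + 6 * t^2 = 5 * n"
    unfolding assms(1) N[symmetric] by (simp add: power2_eq_square algebra_simps)
  ultimately show ?thesis using represents4_sum_squares[of "s * a" "s * b" "s * c" t n] by simp
qed

section \<open>Residue classes modulo 16\<close>

lemma mod_8_cases:
  fixes k :: int
  assumes "0 \<le> k"
  obtains i j where "k = 8 * i + j" "i = 0 \<or> i = 1 \<or> i = 2 \<or> 3 \<le> i"
    "j = 0 \<or> j = 1 \<or> j = 2 \<or> j = 3 \<or> j = 4 \<or> j = 5 \<or> j = 6 \<or> j = 7"
proof (rule that)
  show "k = 8 * (k div 8) + k mod 8" by simp
  have "0 \<le> k div 8" using assms by (simp add: pos_imp_zdiv_nonneg_iff)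
  thus "k div 8 = 0 \<or> k div 8 = 1 \<or> k div 8 = 2 \<or> 3 \<le> k div 8" by linarith
  have "0 \<le> k mod 8" "k mod 8 < 8" by simp_all
  thus "k mod 8 = 0 \<or> k mod 8 = 1 \<or> k mod 8 = 2 \<or> k mod 8 = 3 \<or> k mod 8 = 4 \<or>
      k mod 8 = 5 \<or> k mod 8 = 6 \<or> k mod 8 = 7" by linarith
qed

text \<open>With \<open>s = 2\<close>, \<open>n - x^2\<close> has to be 8 modulo 64. The squares of
  1, 3, ..., 15 run through all residues modulo 64 that are 1 modulo 8, so each \<open>j\<close> has
  its own \<open>x\<close>.\<close>

lemma represents4_one_mod_8:
  assumes "0 \<le> k"
  shows "represents4 1 2 (8 * k + 1)"
proof -
  obtain i j where k: "k = 8 * i + j" and i: "i = 0 \<or> i = 1 \<or> i = 2 \<or> 3 \<le> i"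
    and j: "j = 0 \<or> j = 1 \<or> j = 2 \<or> j = 3 \<or> j = 4 \<or> j = 5 \<or> j = 6 \<or> j = 7"
    using mod_8_cases[OF assms] .
  define n where "n = 64 * i + 8 * j + 1"
  have rep: "represents4 1 2 n" if "n = x^2 + 8 + 64 * c" "0 \<le> c" for x c :: int
    by (rule represents4_square_plus[of n x 2 c]) (use that in simp_all)
  \<comment> \<open>These are the \<open>n\<close> for which that \<open>x\<close> would need a
    negative \<open>c\<close>.\<close>
  have small: "represents4 1 2 n" if "n \<in> {1, 25, 41, 49, 65, 105, 113, 169}"
    using that represents4_I[of 1 1 2 0 0 0 n] represents4_I[of 1 1 2 2 0 2 n]
      represents4_I[of 1 3 2 4 0 0 n] represents4_I[of 1 1 2 0 2 2 n]
      represents4_I[of 1 1 2 0 0 4 n] represents4_I[of 1 3 2 4 0 4 n]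
      represents4_I[of 1 1 2 0 2 4 n] represents4_I[of 1 5 2 0 0 6 n] by auto
  have "represents4 1 2 n"
    using i j rep[of 1 i] rep[of 3 i] rep[of 5 i] rep[of 7 i] rep[of 9 "i - 1"]
      rep[of 11 "i - 2"] rep[of 13 "i - 2"] rep[of 15 "i - 3"] small
    unfolding n_def by (elim disjE) simp_all
  thus ?thesis by (simp add: n_def k)
qed

text \<open>With \<open>s = 4\<close>, \<open>5*n - 6*t^2\<close> has to be 48 modulo 128. This
  prescribes \<open>t^2\<close> modulo 64 as a residue that is 1 modulo 8, attained by one of 1, 3,
  ..., 15.\<close>

lemma represents4_fourteen_mod_16:
  assumes "0 \<le> k"
  shows "represents4 1 2 (16 * k + 14)"
proof -
  obtain i j where k: "k = 8 * i + j" and i: "i = 0 \<or> i = 1 \<or> i = 2 \<or> 3 \<le> i"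
    and j: "j = 0 \<or> j = 1 \<or> j = 2 \<or> j = 3 \<or> j = 4 \<or> j = 5 \<or> j = 6 \<or> j = 7"
    using mod_8_cases[OF assms] .
  define n where "n = 128 * i + 16 * j + 14"
  have rep: "represents4 1 2 n" if "5 * n = 6 * t^2 + 48 + 128 * c" "0 \<le> c" for t c :: int
    by (rule represents4_five[of n t 4 c]) (use that in simp_all)
  \<comment> \<open>Again the cases where \<open>c\<close> would be negative.\<close>
  have small: "represents4 1 2 n" if "n \<in> {14, 30, 78, 110, 126, 254}"
    using that represents4_I[of 1 0 2 1 1 1 n] represents4_I[of 1 0 2 1 1 2 n]
      represents4_I[of 1 0 2 1 2 3 n] represents4_I[of 1 0 2 1 3 3 n]
      represents4_I[of 1 0 2 1 1 5 n] represents4_I[of 1 0 2 1 3 6 n] by auto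
  have "represents4 1 2 n"
    using i j rep[of 5 "5 * i - 1"] rep[of 9 "5 * i - 3"] rep[of 3 "5 * i + 1"]
      rep[of 1 "5 * i + 2"] rep[of 11 "5 * i - 3"] rep[of 7 "5 * i + 1"]
      rep[of 13 "5 * i - 4"] rep[of 15 "5 * i - 6"] small
    unfolding n_def by (elim disjE) simp_all
  thus ?thesis by (simp add: n_def k)
qed

text \<open>With \<open>s = 2\<close>, \<open>5*n - 6*t^2\<close> has to be 12 modulo 32;
  \<open>t = 1\<close> or \<open>t = 3\<close> achieves this, depending on \<open>n\<close> modulo
  32.\<close>

lemma represents4_ten_mod_16:
  assumes "0 \<le> k"
  shows "represents4 1 2 (16 * k + 10)"
proof (cases "even k")
  case True
  then obtain j where "k = 2 * j" by (elim evenE)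
  thus ?thesis using assms represents4_five[of "16 * k + 10" 1 2 "5 * j + 1"] by simp
next
  case False
  then obtain j where j: "k = 2 * j + 1" by (elim oddE)
  hence "0 \<le> j" using assms by presburger
  thus ?thesis using j represents4_five[of "16 * k + 10" 3 2 "5 * j + 2"] by simp
qed

text \<open>With \<open>s = 1\<close>, the residues 2, 3, 6, 11 are \<open>x^2 + 2\<close> for
  \<open>x = 0, 1, 2, 3\<close>. For 5, 7, 13, 15, \<open>5*n - 6*t^2\<close> is 3 modulo 8 with
  \<open>t\<close> equal to 0 or 1. The residues 1, 9, 10, 14 use a larger \<open>s\<close>.\<close>

lemma represents4_not_dvd_4:
  assumes "0 \<le> n" "\<not> 4 dvd n"
  shows "represents4 1 2 n"
proof -
  define k r where "k = n div 16" and "r = n mod 16"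
  have n: "n = 16 * k + r" by (simp add: k_def r_def)
  have k: "0 \<le> k" using assms(1) by (simp add: k_def pos_imp_zdiv_nonneg_iff)
  have "0 \<le> r" "r < 16" by (simp_all add: r_def)
  hence "r = 0 \<or> r = 1 \<or> r = 2 \<or> r = 3 \<or> r = 4 \<or> r = 5 \<or> r = 6 \<or> r = 7 \<or> r = 8 \<or>
      r = 9 \<or> r = 10 \<or> r = 11 \<or> r = 12 \<or> r = 13 \<or> r = 14 \<or> r = 15" by presburger
  moreover have "r \<noteq> 0" "r \<noteq> 4" "r \<noteq> 8" "r \<noteq> 12" using assms(2) unfolding n by auto
  moreover have "represents4 1 2 (16 * k + 9)"
    using represents4_one_mod_8[of "2 * k + 1"] k by (simp add: add.commute)
  ultimately show ?thesis
    using k represents4_one_mod_8[of "2 * k"] represents4_square_plus[of n 0 1 k]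
      represents4_square_plus[of n 1 1 k] represents4_five[of n 1 1 "10 * k + 2"]
      represents4_square_plus[of n 2 1 k] represents4_five[of n 0 1 "10 * k + 4"]
      represents4_ten_mod_16[of k]
      represents4_square_plus[of n 3 1 k] represents4_five[of n 1 1 "10 * k + 7"]
      represents4_fourteen_mod_16[of k] represents4_five[of n 0 1 "10 * k + 9"]
    unfolding n by (elim disjE) simp_all
qed

section \<open>Descent by 4 and determination of the coefficients\<close>

lemma represents4_times_4:
  assumes "represents4 a b n"
  shows "represents4 a b (4 * n)"
proof -
  obtain x y z w where n: "n = a * x^2 + b * y^2 + 4 * (z^2 + z * w + w^2)"
    using assms unfolding represents4_def f4_def by blast
  show ?thesis
    by (rule represents4_I[where x = "2 * x" and y = "2 * y" and z = "2 * z" and w = "2 * w"])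
       (simp add: n power2_eq_square algebra_simps)
qed

lemma represents4_1_2: "0 \<le> n \<Longrightarrow> represents4 1 2 n"
proof (induction "nat n" arbitrary: n rule: less_induct)
  case less
  show ?case
  proof (cases "n = 0 \<or> \<not> 4 dvd n")
    case True
    thus ?thesis using represents4_I[of 1 0 2 0 0 0 0] represents4_not_dvd_4 less.prems by auto
  next
    case False
    hence "4 dvd n" by simp
    then obtain k where "n = 4 * k" by (elim dvdE)
    thus ?thesis using less False represents4_times_4[of 1 2 k] by simp
  qed
qed

text \<open>The binary form is nonnegative, so a nonzero value would contribute at least 4.\<close>

lemma represents4_small:
  assumes "0 < a" "a \<le> b" "n < 4" "represents4 a b n"
  obtains x y where "a * x^2 + b * y^2 = n"
proof -
  obtain x y z w where n: "a * x^2 + b * y^2 + 4 * (z^2 + z * w + w^2) = n"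
    using assms(4) unfolding represents4_def f4_def by blast
  have "0 \<le> a * x^2" "0 \<le> b * y^2" using assms(1,2) by simp_all
  moreover have double: "2 * (z^2 + z * w + w^2) = z^2 + w^2 + (z + w)^2"
    by (simp add: power2_eq_square algebra_simps)
  have "0 \<le> 2 * (z^2 + z * w + w^2)" by (subst double) simp
  hence "0 \<le> z^2 + z * w + w^2" by simp
  moreover define v where "v = z^2 + z * w + w^2"
  ultimately have "v = 0" using n assms(3) unfolding v_def[symmetric] by linarith
  thus thesis using that n unfolding v_def by simp
qed

lemma square_cases: "x = 0 \<or> x^2 = 1 \<or> 4 \<le> x^2" for x :: int
proof -
  have "4 \<le> x^2" if "2 \<le> \<bar>x\<bar>" using power_mono[OF that, of 2] by simp
  moreover have "x = 0 \<or> x = 1 \<or> x = -1 \<or> 2 \<le> \<bar>x\<bar>" by linarith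
  ultimately show ?thesis by auto
qed

theorem theorem6p4:
  fixes a b :: int
  assumes "0 < a" and "a \<le> b"
    and "represents4 a b 1" and "represents4 a b 2" and "represents4 a b 3"
  shows "\<forall>n::int. n \<ge> 0 \<longrightarrow> represents4 a b n"
proof -
  have le: "c \<le> c * x^2" if "0 < c" "x \<noteq> 0" for c x :: int
    using that square_cases[of x] by auto
  obtain x1 y1 where 1: "a * x1^2 + b * y1^2 = 1"
    by (rule represents4_small[OF assms(1,2) _ assms(3)]) auto
  have nn: "0 \<le> a * x^2" "0 \<le> b * x^2" for x using assms(1,2) by simp_all
  \<comment> \<open>A nonzero variable bounds its coefficient by 1, and
    \<open>a \<le> b\<close>.\<close>
  have "x1 \<noteq> 0 \<or> y1 \<noteq> 0" using 1 by auto
  hence "a = 1" using 1 le[of a x1] le[of b y1] nn[of x1] nn[of y1] assms(1,2) by linarith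
  obtain x2 y2 where 2: "x2^2 + b * y2^2 = 2"
    using represents4_small[OF assms(1,2) _ assms(4)] \<open>a = 1\<close> by auto
  \<comment> \<open>2 is not a square.\<close>
  have "y2 \<noteq> 0" using 2 square_cases[of x2] by auto
  hence "b \<le> 2" using 2 le[of b y2] zero_le_power2[of x2] assms(1,2) by linarith
  obtain x3 y3 where 3: "x3^2 + b * y3^2 = 3"
    using represents4_small[OF assms(1,2) _ assms(5)] \<open>a = 1\<close> by auto
  \<comment> \<open>3 is not a sum of two squares.\<close>
  have "b \<noteq> 1"
  proof
    assume "b = 1"
    thus False using 3 square_cases[of x3] square_cases[of y3] zero_le_power2[of x3]
        zero_le_power2[of y3] by auto
  qed
  hence "b = 2" using \<open>b \<le> 2\<close> \<open>a = 1\<close> assms(2) by linarith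
  thus ?thesis using represents4_1_2 \<open>a = 1\<close> by blast
qed

end
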